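(* Let $p$ be a prime and let $G\cong \mathbb{Z}_{p^{r_1}}\times\mathbb{Z}_{p^{r_2}}\times\dots\times\mathbb{Z}_{p^{r_k}}$ be an abelian group of order $p^n$, where $r_1\ge r_2\ge\dots\ge r_k\ge 1$ are integers (so $r_1+\dots+r_k=n$). Put $\ell=r_1$ and, for $1\le j\le \ell$, $s_j=|\{i: r_i\ge j\}|$. Then for each $1\le j\le\ell$ the number of elements of order dividing $p^j$ in $G$ is $p^{s_1+\cdots+s_j}$.
   Context: $\mathbb{Z}_m$ denotes the cyclic group of order $m$. *)

theory Defs
  imports
    "HOL-Algebra.Product_Groups"
    "HOL-Algebra.Multiplicative_Group"
    "HOL-Computational_Algebra.Primes"
begin

end

theory Submission
  imports Defs
begin

text \<open>
  An element of a group has order dividing \<open>m\<close> exactly when its \<open>m\<close>-th power is trivial.  This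
  condition is preserved by isomorphisms and, in a product group, it can be tested one coordinate at
  a time.  The number of solutions is therefore an isomorphism invariant
  (\<open>card_pow_eq_one_iso\<close>) that is multiplicative over finite products
  (\<open>card_pow_eq_one_product_group\<close>).

  In the cyclic group of order \<open>n\<close> the equation \<open>m x = 0\<close> has \<open>gcd m n\<close> solutions
  (\<open>card_pow_eq_one_integer_mod_group\<close>), so the factor of order \<open>p ^ r i\<close> contributes
  \<open>gcd (p ^ j) (p ^ r i) = p ^ min j (r i)\<close>.  The exponent of \<open>p\<close> in the total count is thus
  \<open>\<Sum>i. min j (r i)\<close>.  Viewing the \<open>r i\<close> as the row lengths of a Young diagram, this sum counts the
  cells in the first \<open>j\<close> columns by rows; counting the same cells by columns gives
  \<open>s 1 + \<dots> + s j\<close> (\<open>sum_min_eq_sum_card\<close>).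
\<close>

lemma (in group) ord_dvd_set_eq_pow_set:
  "{x \<in> carrier G. ord x dvd m} = {x \<in> carrier G. x [^] m = \<one>}"
  by (auto simp: pow_eq_id)

lemma card_pow_eq_one_iso:
  fixes m :: nat
  assumes "group G" "group H" "G \<cong> H"
  shows "card {x \<in> carrier G. x [^]\<^bsub>G\<^esub> m = \<one>\<^bsub>G\<^esub>} =
         card {y \<in> carrier H. y [^]\<^bsub>H\<^esub> m = \<one>\<^bsub>H\<^esub>}"
proof -
  interpret G: group G by fact
  obtain h where h: "h \<in> iso G H"
    using assms(3) by (auto simp: is_iso_def)
  interpret h: group_hom G H h
    using h assms by (simp add: group_hom_def group_hom_axioms_def iso_def)
  have bij: "bij_betw h (carrier G) (carrier H)"
    using h by (simp add: iso_def)
  have "h x [^]\<^bsub>H\<^esub> m = \<one>\<^bsub>H\<^esub> \<longleftrightarrow> x [^]\<^bsub>G\<^esub> m = \<one>\<^bsub>G\<^esub>" if "x \<in> carrier G" for x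
    using that bij_betw_imp_inj_on[OF bij]
    by (metis G.nat_pow_closed G.one_closed h.hom_nat_pow h.hom_one inj_onD)
  then have "bij_betw h {x \<in> carrier G. x [^]\<^bsub>G\<^esub> m = \<one>\<^bsub>G\<^esub>} {y \<in> carrier H. y [^]\<^bsub>H\<^esub> m = \<one>\<^bsub>H\<^esub>}"
    using bij by (intro bij_betw_Collect)
  then show ?thesis
    by (rule bij_betw_same_card)
qed

lemma pow_product_group:
  fixes m :: nat
  shows "x [^]\<^bsub>product_group I G\<^esub> m = (\<lambda>i\<in>I. x i [^]\<^bsub>G i\<^esub> m)"
  by (induction m) (auto intro: restrict_ext)

lemma card_pow_eq_one_product_group:
  fixes m :: nat
  assumes "finite I"
  shows "card {x \<in> carrier (product_group I G).
                 x [^]\<^bsub>product_group I G\<^esub> m = \<one>\<^bsub>product_group I G\<^esub>} =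
         (\<Prod>i\<in>I. card {x \<in> carrier (G i). x [^]\<^bsub>G i\<^esub> m = \<one>\<^bsub>G i\<^esub>})"
proof -
  have "{x \<in> carrier (product_group I G).
           x [^]\<^bsub>product_group I G\<^esub> m = \<one>\<^bsub>product_group I G\<^esub>} =
        (\<Pi>\<^sub>E i\<in>I. {x \<in> carrier (G i). x [^]\<^bsub>G i\<^esub> m = \<one>\<^bsub>G i\<^esub>})"
    by (auto simp: pow_product_group PiE_iff fun_eq_iff restrict_def extensional_def)
  then show ?thesis
    using assms by (simp add: card_PiE)
qed

text \<open>
  Put \<open>g = gcd m n\<close> and \<open>n = g c\<close>.  Since \<open>m / g\<close> is coprime to \<open>c\<close>, the congruence
  \<open>m x = 0\<close> modulo \<open>n\<close> says that \<open>c\<close> divides \<open>x\<close>, and the multiples of \<open>c\<close> below \<open>g c\<close> are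
  \<open>0, c, \<dots>, (g - 1) c\<close>.
\<close>

lemma card_pow_eq_one_integer_mod_group:
  fixes m n :: nat
  assumes "n > 0"
  shows "card {x \<in> carrier (integer_mod_group n).
                 x [^]\<^bsub>integer_mod_group n\<^esub> m = \<one>\<^bsub>integer_mod_group n\<^esub>} = gcd m n"
proof -
  define g where "g = gcd m n"
  have "g > 0"
    using assms by (simp add: g_def)
  obtain a c where m: "m = a * g" and n: "n = c * g" and "coprime a c"
    using gcd_coprime_exists[of m n] \<open>g > 0\<close> unfolding g_def by auto
  have "c > 0"
    using assms n by (cases c) auto
  have dvd: "int n dvd int m * x \<longleftrightarrow> int c dvd x" for x
  proof -
    have "int n dvd int m * x \<longleftrightarrow> int g * int c dvd int g * (int a * x)"
      by (simp add: m n mult_ac)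
    also have "\<dots> \<longleftrightarrow> int c dvd x"
      using \<open>g > 0\<close> \<open>coprime a c\<close> by (simp add: coprime_dvd_mult_right_iff coprime_commute)
    finally show ?thesis .
  qed
  have "{x \<in> carrier (integer_mod_group n).
           x [^]\<^bsub>integer_mod_group n\<^esub> m = \<one>\<^bsub>integer_mod_group n\<^esub>} =
        {x \<in> {0..<int n}. int c dvd x}"
    using assms by (auto simp: carrier_integer_mod_group dvd simp flip: dvd_eq_mod_eq_0)
  also have "\<dots> = (\<lambda>t. int c * t) ` {0..<int g}"
    using \<open>c > 0\<close> by (auto simp: n dvd_def zero_le_mult_iff)
  finally show ?thesis
    using \<open>c > 0\<close> by (simp add: card_image inj_on_def g_def)
qed

lemma gcd_power_same_base:
  fixes p :: nat
  shows "gcd (p ^ a) (p ^ b) = p ^ min a b"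
  by (cases "a \<le> b") (simp_all add: le_imp_power_dvd gcd_nat.absorb1 gcd_nat.absorb2 min_def)

text \<open>Double counting of the pairs \<open>(i, t)\<close> with \<open>1 \<le> t \<le> j\<close> and \<open>t \<le> r i\<close>.\<close>

lemma sum_min_eq_sum_card:
  fixes r :: "'i \<Rightarrow> nat"
  assumes "finite I"
  shows "(\<Sum>i\<in>I. min j (r i)) = (\<Sum>t=1..j. card {i \<in> I. r i \<ge> t})"
proof -
  have "(\<Sum>i\<in>I. min j (r i)) = (\<Sum>i\<in>I. card {t \<in> {1..j}. t \<le> r i})"
  proof (rule sum.cong)
    fix i
    have "{t \<in> {1..j}. t \<le> r i} = {1..min j (r i)}"
      by auto
    then show "min j (r i) = card {t \<in> {1..j}. t \<le> r i}"
      by simp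
  qed simp
  also have "\<dots> = (\<Sum>t=1..j. card {i \<in> I. r i \<ge> t})"
    using assms by (intro sum_multicount_gen) auto
  finally show ?thesis .
qed

theorem proposition3p1:
  fixes G :: "('a, 'b) monoid_scheme"
    and p n k l :: nat
    and r s :: "nat \<Rightarrow> nat"
  assumes "prime p"
    and "comm_group G"
    and "order G = p ^ n"
    and "k \<ge> 1"
    and "\<forall>i\<in>{1..<k}. r i \<ge> r (i + 1)"
    and "r k \<ge> 1"
    and "G \<cong> product_group {1..k} (\<lambda>i. integer_mod_group (p ^ r i))"
    and "l = r 1"
    and "\<forall>j\<in>{1..l}. s j = card {i \<in> {1..k}. r i \<ge> j}"
  shows "\<forall>j\<in>{1..l}.
    card {x \<in> carrier G. group.ord G x dvd p ^ j} = p ^ (\<Sum>i=1..j. s i)"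
proof
  fix j assume j: "j \<in> {1..l}"
  let ?Z = "\<lambda>i. integer_mod_group (p ^ r i)"
  let ?P = "product_group {1..k} ?Z"
  interpret comm_group G by fact
  have "p > 0"
    using assms(1) by (rule prime_gt_0_nat)
  have "card {x \<in> carrier G. ord x dvd p ^ j} =
        card {x \<in> carrier ?P. x [^]\<^bsub>?P\<^esub> (p ^ j) = \<one>\<^bsub>?P\<^esub>}"
    unfolding ord_dvd_set_eq_pow_set
    by (rule card_pow_eq_one_iso) (use assms(7) in auto)
  also have "\<dots> = (\<Prod>i=1..k. gcd (p ^ j) (p ^ r i))"
    using \<open>p > 0\<close>
    by (subst card_pow_eq_one_product_group)
       (simp_all add: card_pow_eq_one_integer_mod_group del: pow_integer_mod_group one_integer_mod_group)
  also have "\<dots> = p ^ (\<Sum>i=1..k. min j (r i))"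
    by (simp add: gcd_power_same_base power_sum)
  also have "(\<Sum>i=1..k. min j (r i)) = (\<Sum>t=1..j. s t)"
    using j assms(9) by (simp add: sum_min_eq_sum_card)
  finally show "card {x \<in> carrier G. ord x dvd p ^ j} = p ^ (\<Sum>i=1..j. s i)" .
qed

end
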